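(* Let $n\ge 1$ be an integer and let $S_{3,n}$ be the triangular snake with $n$ triangles. Then $$\mathcal{L}(S_{3,n}) = 2^{n}(n-1)!\left(\sum_{k=0}^{n-1}\frac{\binom{2n-1}{2k}}{\binom{n-1}{k}}+n\sum_{k=0}^{n}\frac{\binom{2n}{2k}}{\binom{n}{k}}\right).$$
   Context: Let $H$ be a finite, connected, undirected graph with vertex set $V$. A random walk labeling of $H$ is a labeling of $V$ obtainable by the following process: (1) set $i=1$, choose any $v\in V$ and label $v$ with $i$; (2) as long as there are unlabeled vertices, choose a vertex $w$ adjacent to the current vertex $v$ and replace $v$ by $w$; if this new $v$ is not labeled, increase $i$ by $1$ and label $v$ with $i$. The number of different random walk labelings of $H$ is denoted by $\mathcal{L}(H)$. The triangular snake $S_{3,n}$ is obtained from a path graph $P_{n+1}$ on $n+1$ vertices by replacing each edge of the path with an edge of a triangle; that is, for each of the $n$ edges $uv$ of the path, one new vertex adjacent to exactly $u$ and $v$ is added (so the graph has $2n+1$ vertices). *)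

theory Defs
  imports Complex_Main "Graph_Theory.Digraph_Component"
begin

text \<open>
  An undirected graph is a \<^locale>\<open>pair_graph\<close>: finite, loop-free, and with a symmetric arc
  relation, so that the edge between \<open>u\<close> and \<open>v\<close> is the pair of arcs \<open>(u, v)\<close> and \<open>(v, u)\<close>.
\<close>

text \<open>
  \<open>rw_process H v i l\<close>: the process can reach a situation in which the walk is at vertex \<open>v\<close>, the
  largest label used so far is \<open>i\<close>, and \<open>l\<close> is the current partial labeling.
\<close>

inductive rw_process :: "'a pair_pre_digraph \<Rightarrow> 'a \<Rightarrow> nat \<Rightarrow> ('a \<rightharpoonup> nat) \<Rightarrow> bool"
  for H :: "'a pair_pre_digraph" where
  start: "v \<in> pverts H \<Longrightarrow> rw_process H v 1 [v \<mapsto> 1]"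
| step_old: "rw_process H v i l \<Longrightarrow> \<not> pverts H \<subseteq> dom l \<Longrightarrow> (v, w) \<in> parcs H \<Longrightarrow> w \<in> dom l
    \<Longrightarrow> rw_process H w i l"
| step_new: "rw_process H v i l \<Longrightarrow> \<not> pverts H \<subseteq> dom l \<Longrightarrow> (v, w) \<in> parcs H \<Longrightarrow> w \<notin> dom l
    \<Longrightarrow> rw_process H w (i + 1) (l(w \<mapsto> i + 1))"

definition rw_labelings :: "'a pair_pre_digraph \<Rightarrow> ('a \<rightharpoonup> nat) set" where
  "rw_labelings H = {l. (\<exists>v i. rw_process H v i l) \<and> dom l = pverts H}"

definition num_rw_labelings :: "'a pair_pre_digraph \<Rightarrow> nat" where
  "num_rw_labelings H = card (rw_labelings H)"

text \<open>
  In the triangular snake with \<open>n\<close> triangles, \<open>Base 0, \<dots>, Base n\<close> are the vertices of the path and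
  \<open>Apex i\<close>, for \<open>i < n\<close>, is the vertex added for the edge between \<open>Base i\<close> and \<open>Base (i + 1)\<close>.
\<close>

datatype snake_vertex = Base nat | Apex nat

definition snake_half_arcs :: "nat \<Rightarrow> snake_vertex rel" where
  "snake_half_arcs n =
    (\<Union>i<n. {(Base i, Base (i + 1)), (Base i, Apex i), (Apex i, Base (i + 1))})"

definition triangular_snake :: "nat \<Rightarrow> snake_vertex pair_pre_digraph" where
  "triangular_snake n = \<lparr> pverts = Base ` {..n} \<union> Apex ` {..<n},
     parcs = snake_half_arcs n \<union> (snake_half_arcs n)\<inverse> \<rparr>"

lemma card_pverts_triangular_snake: "card (pverts (triangular_snake n)) = 2 * n + 1"
proof -
  have "card (Base ` {..n} \<union> Apex ` {..<n}) = card (Base ` {..n}) + card (Apex ` {..<n})"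
    by (rule card_Un_disjoint) auto
  then show ?thesis
    by (simp add: triangular_snake_def card_image inj_on_def)
qed

lemma pair_graph_triangular_snake: "pair_graph (triangular_snake n)"
proof -
  have "finite (snake_half_arcs n)"
    by (simp add: snake_half_arcs_def)
  then show ?thesis
    by unfold_locales
      (auto simp: triangular_snake_def snake_half_arcs_def symmetric_def sym_def)
qed

lemma connected_triangular_snake: "Digraph_Component.connected (triangular_snake n)"
proof -
  let ?G = "with_proj (triangular_snake n)"
  interpret pair_graph "triangular_snake n" by (rule pair_graph_triangular_snake)
  have wf: "wf_digraph ?G" by (rule wf_digraph)
  have sym: "symmetric ?G" by (rule sym_arcs)
  have base: "i \<le> n \<Longrightarrow> Base 0 \<rightarrow>\<^sup>*\<^bsub>?G\<^esub> Base i" for i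
  proof (induction i)
    case 0
    show ?case by (rule reachable_refl) (simp add: triangular_snake_def)
  next
    case (Suc i)
    then have "Base i \<rightarrow>\<^bsub>?G\<^esub> Base (Suc i)"
      by (auto simp: triangular_snake_def snake_half_arcs_def)
    moreover have "Base 0 \<rightarrow>\<^sup>*\<^bsub>?G\<^esub> Base i" using Suc by simp
    ultimately show ?case by (rule wf_digraph.reachable_adj_trans[OF wf, rotated])
  qed
  have apex: "Base 0 \<rightarrow>\<^sup>*\<^bsub>?G\<^esub> Apex i" if "i < n" for i
  proof -
    have "Base i \<rightarrow>\<^bsub>?G\<^esub> Apex i"
      using that by (auto simp: triangular_snake_def snake_half_arcs_def)
    moreover have "Base 0 \<rightarrow>\<^sup>*\<^bsub>?G\<^esub> Base i" using base[of i] that by simp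
    ultimately show ?thesis by (rule wf_digraph.reachable_adj_trans[OF wf, rotated])
  qed
  have all: "Base 0 \<rightarrow>\<^sup>*\<^bsub>?G\<^esub> v" if "v \<in> pverts (triangular_snake n)" for v
    using that base apex by (auto simp: triangular_snake_def)
  have "strongly_connected ?G"
  proof (rule strongly_connectedI)
    show "verts ?G \<noteq> {}" by (simp add: triangular_snake_def)
    fix u v assume "u \<in> verts ?G" "v \<in> verts ?G"
    then have "Base 0 \<rightarrow>\<^sup>*\<^bsub>?G\<^esub> u" "Base 0 \<rightarrow>\<^sup>*\<^bsub>?G\<^esub> v" using all by simp_all
    then show "u \<rightarrow>\<^sup>*\<^bsub>?G\<^esub> v"
      using symmetric_reachable[OF sym] reachable_trans by blast
  qed
  moreover have "mk_symmetric ?G = triangular_snake n"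
    unfolding mk_symmetric_def with_proj_simps by (auto simp: triangular_snake_def)
  ultimately show ?thesis
    by (simp only: connected_def)
qed

lemma rw_process_range: "rw_process H v i l \<Longrightarrow> i \<le> card (dom l) \<and> finite (dom l) \<and> ran l \<subseteq> {1..i}"
proof (induction rule: rw_process.induct)
  case (start v)
  show ?case by (simp del: fun_upd_apply)
next
  case (step_old v i l w)
  then show ?case by simp
next
  case (step_new v i l w)
  have "ran (l(w \<mapsto> i + 1)) \<subseteq> insert (i + 1) (ran l)"
    by (auto simp: ran_def)
  also have "\<dots> \<subseteq> {1..i + 1}"
    using step_new.IH by auto
  finally show ?case
    using step_new.IH step_new.hyps(4) by (simp del: fun_upd_apply)
qed

text \<open>The set of labelings of a finite graph is finite, so its \<^const>\<open>card\<close> is meaningful.\<close>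

lemma finite_rw_labelings:
  assumes "finite (pverts H)"
  shows "finite (rw_labelings H)"
proof (rule finite_subset)
  show "rw_labelings H \<subseteq> {l. dom l = pverts H \<and> ran l \<subseteq> {1..card (pverts H)}}"
  proof
    fix l assume "l \<in> rw_labelings H"
    then obtain v i where p: "rw_process H v i l" and d: "dom l = pverts H"
      by (auto simp: rw_labelings_def)
    from rw_process_range[OF p] have "ran l \<subseteq> {1..i}" "i \<le> card (pverts H)"
      using d by simp_all
    then have "ran l \<subseteq> {1..card (pverts H)}" by (meson atLeastatMost_subset_iff order_refl subset_trans)
    with d show "l \<in> {l. dom l = pverts H \<and> ran l \<subseteq> {1..card (pverts H)}}" by simp
  qed
  show "finite {l. dom l = pverts H \<and> ran l \<subseteq> {1..card (pverts H)}}"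
    using assms by (rule finite_set_of_finite_maps) simp
qed

end

theory Submission
  imports Defs
begin

text \<open>
  A random walk labeling amounts to an ordering of the vertices in which every vertex but the first
  has an earlier neighbour. In the snake, once a base vertex is labeled, the labeled base vertices
  form an interval from \<open>a\<close> to \<open>b\<close>. The number of ways to complete the labeling is then
  \<open>m! d(a) d(n - b)\<close>, where \<open>m\<close> is the number of unlabeled vertices and
  \<open>d(j) = 1 / (1 \<cdot> 3 \<cdots> (2 j - 1))\<close>. Indeed, labeling an apex does not change the weight
  \<open>d(a) d(n - b)\<close>, whereas extending the interval to the left multiplies it by \<open>2 a - 1\<close> and
  extending it to the right by \<open>2 (n - b) - 1\<close>; so the weights of the possible successors add up to
  \<open>m\<close> times the weight.
\<close>

section \<open>Random walk labelings as vertex orderings\<close>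

text \<open>Simplification turns an updated map into this form before \<^const>\<open>dom\<close> can be evaluated.\<close>

lemma dom_if_Some [simp]: "dom (\<lambda>a. if a = w then Some y else l a) = insert w (dom l)"
  by auto

section \<open>Partial labelings extended by adjacent vertices\<close>

definition frontier :: "'a pair_pre_digraph \<Rightarrow> 'a set \<Rightarrow> 'a set" where
  "frontier H S = {w \<in> pverts H - S. \<exists>v\<in>S. (v, w) \<in> parcs H}"

text \<open>The position of the walk and its counter are left out: while a vertex is missing the
  walk can return to any labeled vertex, and the counter always equals the number of labeled
  vertices.\<close>

definition label_step :: "'a pair_pre_digraph \<Rightarrow> ('a \<rightharpoonup> nat) rel" where
  "label_step H = {(l, l(w \<mapsto> card (dom l) + 1)) | l w. w \<in> frontier H (dom l)}"

definition completions :: "'a pair_pre_digraph \<Rightarrow> ('a \<rightharpoonup> nat) \<Rightarrow> ('a \<rightharpoonup> nat) set" where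
  "completions H l = {L. (l, L) \<in> (label_step H)\<^sup>* \<and> dom L = pverts H}"

lemma label_step_finite_dom:
  "(l, L) \<in> (label_step H)\<^sup>* \<Longrightarrow> finite (dom l) \<Longrightarrow> finite (dom L)"
  by (induction rule: rtrancl_induct) (auto simp: label_step_def)

text \<open>Each step writes a label above the current number of labels onto a fresh vertex. The
  last two facts later tell apart completions that begin differently: a chosen vertex keeps its
  label, a postponed one gets a larger label.\<close>

lemma label_step_extends:
  assumes "(l, L) \<in> (label_step H)\<^sup>*" "finite (dom l)"
  shows "card (dom l) \<le> card (dom L)"
    and "x \<in> dom l \<Longrightarrow> L x = l x"
    and "x \<notin> dom l \<Longrightarrow> L x = Some j \<Longrightarrow> card (dom l) < j"
proof -
  have "card (dom l) \<le> card (dom L) \<and> (\<forall>x\<in>dom l. L x = l x)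
      \<and> (\<forall>x j. x \<notin> dom l \<longrightarrow> L x = Some j \<longrightarrow> card (dom l) < j)"
    using assms(1)
  proof (induction rule: rtrancl_induct)
    case base
    then show ?case by auto
  next
    case (step M N)
    obtain w where w: "w \<in> frontier H (dom M)" "N = M(w \<mapsto> card (dom M) + 1)"
      using step.hyps(2) by (auto simp: label_step_def)
    have "finite (dom M)" "w \<notin> dom M"
      using label_step_finite_dom[OF step.hyps(1) assms(2)] w by (auto simp: frontier_def)
    moreover have "dom l \<subseteq> dom M"
      using step.IH by (metis domIff subsetI)
    moreover have "card (dom N) = card (dom M) + 1"
      using calculation w(2) by (simp del: fun_upd_apply)
    ultimately show ?case
      using step.IH w by auto
  qed
  then show "card (dom l) \<le> card (dom L)"
    "x \<in> dom l \<Longrightarrow> L x = l x" "x \<notin> dom l \<Longrightarrow> L x = Some j \<Longrightarrow> card (dom l) < j"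
    by auto
qed

lemma completions_full:
  assumes "dom l = pverts H"
  shows "completions H l = {l}"
proof -
  have "frontier H (dom l) = {}"
    using assms by (auto simp: frontier_def)
  then have "(l, M) \<notin> label_step H" for M
    by (auto simp: label_step_def)
  then show ?thesis
    using assms by (auto simp: completions_def elim: converse_rtranclE)
qed

lemma completions_step:
  assumes "dom l \<noteq> pverts H"
  shows "completions H l = (\<Union>w\<in>frontier H (dom l). completions H (l(w \<mapsto> card (dom l) + 1)))"
proof (intro equalityI subsetI)
  fix L assume "L \<in> completions H l"
  then have L: "(l, L) \<in> (label_step H)\<^sup>*" "dom L = pverts H"
    by (auto simp: completions_def)
  with assms have "l \<noteq> L" by auto
  with L(1) obtain M where "(l, M) \<in> label_step H" "(M, L) \<in> (label_step H)\<^sup>*"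
    by (meson converse_rtranclE)
  with L(2) show "L \<in> (\<Union>w\<in>frontier H (dom l). completions H (l(w \<mapsto> card (dom l) + 1)))"
    by (auto simp: completions_def label_step_def)
next
  fix L assume "L \<in> (\<Union>w\<in>frontier H (dom l). completions H (l(w \<mapsto> card (dom l) + 1)))"
  then obtain w where w: "w \<in> frontier H (dom l)"
    "(l(w \<mapsto> card (dom l) + 1), L) \<in> (label_step H)\<^sup>*" "dom L = pverts H"
    by (auto simp: completions_def)
  have "(l, l(w \<mapsto> card (dom l) + 1)) \<in> label_step H"
    using w(1) by (auto simp: label_step_def)
  with w show "L \<in> completions H l"
    by (auto simp: completions_def intro: converse_rtrancl_into_rtrancl)
qed

lemma finite_frontier: "finite (pverts H) \<Longrightarrow> finite (frontier H S)"
  by (auto simp: frontier_def)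

lemma finite_completions:
  assumes "finite (pverts H)" "dom l \<subseteq> pverts H"
  shows "finite (completions H l)"
  using assms(2)
proof (induction "card (pverts H - dom l)" arbitrary: l rule: less_induct)
  case less
  show ?case
  proof (cases "dom l = pverts H")
    case True
    then show ?thesis by (simp add: completions_full)
  next
    case False
    have "finite (completions H (l(w \<mapsto> card (dom l) + 1)))" if "w \<in> frontier H (dom l)" for w
    proof (rule less.hyps)
      show "card (pverts H - dom (l(w \<mapsto> card (dom l) + 1))) < card (pverts H - dom l)"
        using that assms(1) by (intro psubset_card_mono) (auto simp: frontier_def)
      show "dom (l(w \<mapsto> card (dom l) + 1)) \<subseteq> pverts H"
        using that less.prems by (simp add: frontier_def)
    qed
    then show ?thesis
      using finite_frontier[OF assms(1)] by (subst completions_step[OF False]) blast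
  qed
qed

lemma card_completions_step:
  assumes "finite (pverts H)" "dom l \<subseteq> pverts H" "dom l \<noteq> pverts H"
  shows "card (completions H l) =
    (\<Sum>w\<in>frontier H (dom l). card (completions H (l(w \<mapsto> card (dom l) + 1))))"
  unfolding completions_step[OF assms(3)]
proof (rule card_UN_disjoint[OF finite_frontier[OF assms(1)]])
  let ?l = "\<lambda>w. l(w \<mapsto> card (dom l) + 1)"
  show "\<forall>w\<in>frontier H (dom l). finite (completions H (?l w))"
    using assms by (intro ballI finite_completions) (simp_all add: frontier_def)
  have fin: "finite (dom l)"
    using assms finite_subset by blast
  have False if "v \<in> frontier H (dom l)" "w \<in> frontier H (dom l)" "v \<noteq> w"
    "L \<in> completions H (?l v)" "L \<in> completions H (?l w)" for v w L
  proof -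
    have "(?l v, L) \<in> (label_step H)\<^sup>*" "(?l w, L) \<in> (label_step H)\<^sup>*"
      using that by (auto simp: completions_def)
    note steps = this
    \<comment> \<open>Choosing \<open>v\<close> fixes its label to \<open>card (dom l) + 1\<close>;
      choosing \<open>w\<close> instead spends that label, so \<open>v\<close> gets a larger
      one.\<close>
    have "L v = Some (card (dom l) + 1)"
      using label_step_extends(2)[OF steps(1), of v] fin by simp
    moreover have "v \<notin> dom (?l w)" "card (dom (?l w)) = card (dom l) + 1"
      using that fin by (auto simp: frontier_def)
    ultimately show False
      using label_step_extends(3)[OF steps(2), of v] fin by fastforce
  qed
  then show "\<forall>v\<in>frontier H (dom l). \<forall>w\<in>frontier H (dom l). v \<noteq> w \<longrightarrow>
      completions H (?l v) \<inter> completions H (?l w) = {}"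
    by blast
qed

section \<open>Equivalence of the walk and the frontier process\<close>

text \<open>Every fresh vertex is attached to the vertex the walk came from, and by symmetry the
  walk can go back, so the labeled vertices stay connected among themselves.\<close>

lemma rw_process_connected:
  assumes "rw_process H v i l" "sym (parcs H)"
  shows "v \<in> dom l \<and> (\<forall>u\<in>dom l. (v, u) \<in> (parcs H \<inter> dom l \<times> dom l)\<^sup>*)"
  using assms(1)
proof (induction rule: rw_process.induct)
  case (start v)
  then show ?case by (simp del: fun_upd_apply)
next
  case (step_old v i l w)
  have "(w, v) \<in> parcs H \<inter> dom l \<times> dom l"
    using step_old assms(2) by (auto dest: symD)
  then show ?case
    using step_old by (meson converse_rtrancl_into_rtrancl)
next
  case (step_new v i l w)
  let ?D = "dom (l(w \<mapsto> i + 1))"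
  have wv: "(w, v) \<in> parcs H \<inter> ?D \<times> ?D"
    using step_new assms(2) by (auto dest: symD)
  have "(parcs H \<inter> dom l \<times> dom l)\<^sup>* \<subseteq> (parcs H \<inter> ?D \<times> ?D)\<^sup>*"
    by (rule rtrancl_mono) auto
  then have "(v, u) \<in> (parcs H \<inter> ?D \<times> ?D)\<^sup>*" if "u \<in> dom l" for u
    using step_new that by blast
  then show ?case
    using wv by (auto intro: converse_rtrancl_into_rtrancl)
qed

text \<open>A path through labeled vertices uses only \<open>step_old\<close>, which changes neither
  labels nor counter. A missing vertex ensures that the process has not stopped.\<close>

lemma rw_process_walk:
  assumes "rw_process H v i l" "sym (parcs H)" "\<not> pverts H \<subseteq> dom l" "u \<in> dom l"
  shows "rw_process H u i l"
proof -
  have "(v, u) \<in> (parcs H \<inter> dom l \<times> dom l)\<^sup>*"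
    using rw_process_connected[OF assms(1,2)] assms(4) by blast
  then show ?thesis
    by (induction rule: rtrancl_induct) (use assms in \<open>auto intro: rw_process.step_old\<close>)
qed

text \<open>A move to a labeled vertex changes nothing; a move to a new one enters the frontier
  because the walk stands on a labeled vertex. Carrying \<open>card (dom l) = i\<close> along makes
  the new labels agree.\<close>

lemma label_steps_if_rw_process:
  assumes "rw_process H v i l" "parcs H \<subseteq> pverts H \<times> pverts H" "sym (parcs H)"
  shows "finite (dom l) \<and> card (dom l) = i \<and> (\<exists>v0\<in>pverts H. ([v0 \<mapsto> 1], l) \<in> (label_step H)\<^sup>*)"
  using assms(1)
proof (induction rule: rw_process.induct)
  case (start v)
  then show ?case by auto
next
  case (step_old v i l w)
  then show ?case by simp
next
  case (step_new v i l w)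
  have "v \<in> dom l"
    using rw_process_connected[OF step_new.hyps(1) assms(3)] by blast
  then have "w \<in> frontier H (dom l)"
    using step_new assms(2) by (auto simp: frontier_def)
  then have "(l, l(w \<mapsto> i + 1)) \<in> label_step H"
    using step_new.IH by (auto simp: label_step_def)
  then have "([v0 \<mapsto> 1], l(w \<mapsto> i + 1)) \<in> (label_step H)\<^sup>*"
    if "([v0 \<mapsto> 1], l) \<in> (label_step H)\<^sup>*" for v0
    using that by (rule rtrancl_into_rtrancl[rotated])
  then show ?case
    using step_new.IH step_new.hyps(4) by (auto simp del: fun_upd_apply)
qed

lemma rw_process_if_label_steps:
  assumes "([v0 \<mapsto> 1], l) \<in> (label_step H)\<^sup>*" "v0 \<in> pverts H" "sym (parcs H)"
  shows "finite (dom l) \<and> (\<exists>v. rw_process H v (card (dom l)) l)"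
  using assms(1)
proof (induction rule: rtrancl_induct)
  case base
  then show ?case
    using rw_process.start[OF assms(2)] by (auto simp del: fun_upd_apply)
next
  case (step l M)
  obtain w u where w: "w \<in> pverts H" "w \<notin> dom l" "u \<in> dom l" "(u, w) \<in> parcs H"
    "M = l(w \<mapsto> card (dom l) + 1)"
    using step.hyps(2) by (auto simp: label_step_def frontier_def)
  obtain v where v: "rw_process H v (card (dom l)) l"
    using step.IH by blast
  have "\<not> pverts H \<subseteq> dom l"
    using w by blast
  \<comment> \<open>The walk first goes to the labeled neighbour \<open>u\<close> of
    \<open>w\<close>; from there the move to \<open>w\<close> is a \<open>step_new\<close>.\<close>
  then have "rw_process H w (card (dom l) + 1) M"
    using rw_process.step_new[OF rw_process_walk[OF v assms(3) _ w(3)]] w by simp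
  moreover have "finite (dom M)" "card (dom M) = card (dom l) + 1"
    using step.IH w by simp_all
  ultimately show ?case
    by auto
qed

lemma rw_labelings_eq_completions:
  assumes "parcs H \<subseteq> pverts H \<times> pverts H" "sym (parcs H)"
  shows "rw_labelings H = (\<Union>v\<in>pverts H. completions H [v \<mapsto> 1])"
  using label_steps_if_rw_process[OF _ assms] rw_process_if_label_steps[OF _ _ assms(2)]
  by (fastforce simp: rw_labelings_def completions_def)

lemma num_rw_labelings_eq_sum:
  assumes "finite (pverts H)" "parcs H \<subseteq> pverts H \<times> pverts H" "sym (parcs H)"
  shows "num_rw_labelings H = (\<Sum>v\<in>pverts H. card (completions H [v \<mapsto> 1]))"
  unfolding num_rw_labelings_def rw_labelings_eq_completions[OF assms(2,3)]
proof (rule card_UN_disjoint[OF assms(1)])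
  show "\<forall>v\<in>pverts H. finite (completions H [v \<mapsto> 1])"
    using assms(1) by (intro ballI finite_completions) simp_all
  have False if "v \<noteq> w" "L \<in> completions H [v \<mapsto> 1]" "L \<in> completions H [w \<mapsto> 1]" for v w L
  proof -
    have steps: "([v \<mapsto> 1], L) \<in> (label_step H)\<^sup>*" "([w \<mapsto> 1], L) \<in> (label_step H)\<^sup>*"
      using that by (auto simp: completions_def)
    \<comment> \<open>A start at \<open>v\<close> gives \<open>v\<close> the label 1, a start at
      \<open>w\<close> gives it a label above 1.\<close>
    show False
      using label_step_extends(2)[OF steps(1), of v] label_step_extends(3)[OF steps(2), of v 1] that(1)
      by simp
  qed
  then show "\<forall>v\<in>pverts H. \<forall>w\<in>pverts H. v \<noteq> w \<longrightarrow>
      completions H [v \<mapsto> 1] \<inter> completions H [w \<mapsto> 1] = {}"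
    by blast
qed

section \<open>The triangular snake\<close>

text \<open>This is \<open>1 / (1 * 3 * ... * (2 j - 1))\<close>, since
  \<open>(2 j)! = 2^j j! (1 * 3 * ... * (2 j - 1))\<close>. The factorial form later combines with
  the binomial coefficients.\<close>

definition tail_weight :: "nat \<Rightarrow> real" where
  "tail_weight j = 2 ^ j * fact j / fact (2 * j)"

lemma tail_weight_0 [simp]: "tail_weight 0 = 1"
  by (simp add: tail_weight_def)

lemma tail_weight_Suc: "tail_weight j = (2 * real j + 1) * tail_weight (Suc j)"
  by (simp add: tail_weight_def divide_simps)

text \<open>The shape of every labeled set that contains a base vertex; \<open>A\<close> holds the
  indices of the labeled apexes.\<close>

definition snake_block :: "nat \<Rightarrow> nat \<Rightarrow> nat set \<Rightarrow> snake_vertex set" where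
  "snake_block a b A = Base ` {a..b} \<union> Apex ` A"

lemma insert_snake_block:
  "insert (Apex i) (snake_block a b A) = snake_block a b (insert i A)"
  "a > 0 \<Longrightarrow> a \<le> b \<Longrightarrow> insert (Base (a - 1)) (snake_block a b A) = snake_block (a - 1) b A"
  "a \<le> b \<Longrightarrow> insert (Base (b + 1)) (snake_block a b A) = snake_block a (b + 1) A"
proof -
  show "insert (Apex i) (snake_block a b A) = snake_block a b (insert i A)"
    by (auto simp: snake_block_def)
next
  assume "a > 0" "a \<le> b"
  then have "{a - 1..b} = insert (a - 1) {a..b}" by auto
  then show "insert (Base (a - 1)) (snake_block a b A) = snake_block (a - 1) b A"
    by (simp add: snake_block_def)
next
  assume "a \<le> b"
  then have "{a..b + 1} = insert (b + 1) {a..b}" by auto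
  then show "insert (Base (b + 1)) (snake_block a b A) = snake_block a (b + 1) A"
    by (simp add: snake_block_def)
qed

lemma parcs_triangular_snake:
  "(Base i, Base j) \<in> parcs (triangular_snake n) \<longleftrightarrow> i = j + 1 \<and> i \<le> n \<or> j = i + 1 \<and> j \<le> n"
  "(Base i, Apex j) \<in> parcs (triangular_snake n) \<longleftrightarrow> j < n \<and> (i = j \<or> i = j + 1)"
  "(Apex j, Base i) \<in> parcs (triangular_snake n) \<longleftrightarrow> j < n \<and> (i = j \<or> i = j + 1)"
  "(Apex i, Apex j) \<notin> parcs (triangular_snake n)"
  by (auto simp: triangular_snake_def snake_half_arcs_def)

lemma pverts_triangular_snake:
  "Base i \<in> pverts (triangular_snake n) \<longleftrightarrow> i \<le> n"
  "Apex i \<in> pverts (triangular_snake n) \<longleftrightarrow> i < n"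
  by (auto simp: triangular_snake_def)

lemma finite_pverts_triangular_snake: "finite (pverts (triangular_snake n))"
  by (simp add: triangular_snake_def)

text \<open>Apexes are pairwise non-adjacent, so a labeled set without base vertices occurs only
  right after a start at an apex.\<close>

lemma frontier_Apex:
  assumes "i < n"
  shows "frontier (triangular_snake n) {Apex i} = {Base i, Base (i + 1)}"
proof (rule set_eqI)
  fix x
  show "x \<in> frontier (triangular_snake n) {Apex i} \<longleftrightarrow> x \<in> {Base i, Base (i + 1)}"
    using assms
    by (cases x) (auto simp: frontier_def parcs_triangular_snake pverts_triangular_snake)
qed

text \<open>Apex \<open>i\<close> touches the interval iff \<open>a - 1 \<le> i \<le> b\<close>;
  truncated subtraction covers \<open>a = 0\<close>, and \<open>min n\<close> cuts off the missing
  apex at \<open>b = n\<close>. The hypothesis on \<open>A\<close> says that labeled apexes touch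
  the interval, so they open no base vertices beyond its two neighbours.\<close>

lemma frontier_snake_block:
  assumes "a \<le> b" "b \<le> n" "A \<subseteq> {a - 1..<min n (b + 1)}"
  shows "frontier (triangular_snake n) (snake_block a b A) =
    Apex ` ({a - 1..<min n (b + 1)} - A) \<union>
    ((if a > 0 then {Base (a - 1)} else {}) \<union> (if b < n then {Base (b + 1)} else {}))"
    (is "_ = ?R")
proof (rule set_eqI)
  fix x
  show "x \<in> frontier (triangular_snake n) (snake_block a b A) \<longleftrightarrow> x \<in> ?R"
  proof (cases x)
    case (Base j)
    have "(\<exists>v\<in>snake_block a b A. (v, Base j) \<in> parcs (triangular_snake n)) \<and> j \<le> n \<and> j \<notin> {a..b}
      \<longleftrightarrow> a > 0 \<and> j = a - 1 \<or> b < n \<and> j = b + 1" (is "?L \<longleftrightarrow> ?Q")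
    proof
      assume ?L
      then obtain v where v: "v \<in> snake_block a b A" "(v, Base j) \<in> parcs (triangular_snake n)"
        and j: "j \<le> n" "j \<notin> {a..b}"
        by blast
      show ?Q
      proof (cases v)
        case (Base i)
        then show ?thesis
          using v j assms by (auto simp: snake_block_def parcs_triangular_snake)
      next
        case (Apex i)
        then have "i \<in> A" "j = i \<or> j = i + 1"
          using v by (auto simp: snake_block_def parcs_triangular_snake)
        moreover from \<open>i \<in> A\<close> have "a - 1 \<le> i" "i < n" "i < b + 1"
          using assms(3) by auto
        ultimately show ?thesis
          using j assms by auto
      qed
    next
      assume Q: ?Q
      have "(Base a, Base (a - 1)) \<in> parcs (triangular_snake n)" if "a > 0"
        using that assms by (simp add: parcs_triangular_snake)
      moreover have "(Base b, Base (b + 1)) \<in> parcs (triangular_snake n)" if "b < n"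
        using that assms by (simp add: parcs_triangular_snake)
      moreover have "Base a \<in> snake_block a b A" "Base b \<in> snake_block a b A"
        using assms by (auto simp: snake_block_def)
      ultimately show ?L
        using Q assms by auto
    qed
    then show ?thesis
      using Base by (auto simp: frontier_def pverts_triangular_snake snake_block_def)
  next
    case (Apex j)
    \<comment> \<open>All neighbours of an apex are base vertices, so the interval alone decides
      adjacency.\<close>
    have "(\<exists>v\<in>snake_block a b A. (v, Apex j) \<in> parcs (triangular_snake n)) \<longleftrightarrow>
        j < n \<and> (j \<in> {a..b} \<or> j + 1 \<in> {a..b})"
      by (auto simp: snake_block_def bex_Un parcs_triangular_snake simp del: bex_simps(8))
    moreover have "Apex j \<in> snake_block a b A \<longleftrightarrow> j \<in> A"
      by (auto simp: snake_block_def)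
    ultimately have "x \<in> frontier (triangular_snake n) (snake_block a b A) \<longleftrightarrow>
        j < n \<and> (j \<in> {a..b} \<or> j + 1 \<in> {a..b}) \<and> j \<notin> A"
      unfolding Apex frontier_def by (simp add: pverts_triangular_snake) blast
    also have "\<dots> \<longleftrightarrow> j \<in> {a - 1..<min n (b + 1)} - A"
      using assms(1,2) by auto
    also have "\<dots> \<longleftrightarrow> x \<in> ?R"
      unfolding Apex by auto
    finally show ?thesis .
  qed
qed

section \<open>Counting the completions of a block\<close>

text \<open>Adding \<open>card A\<close> on the left spares a subtraction for the unlabeled
  apexes.\<close>

lemma card_unlabeled_snake_block:
  assumes "a \<le> b" "b \<le> n" "A \<subseteq> {..<n}"
  shows "card (pverts (triangular_snake n) - snake_block a b A) + card A = a + (n - b) + n"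
proof -
  have mem: "Base i \<in> Base ` X \<longleftrightarrow> i \<in> X" "Apex i \<in> Apex ` X \<longleftrightarrow> i \<in> X"
    "Base i \<notin> Apex ` X" "Apex i \<notin> Base ` X" for i X
    by auto
  have "pverts (triangular_snake n) - snake_block a b A
      = Base ` ({..<a} \<union> {b<..n}) \<union> Apex ` ({..<n} - A)"
  proof (rule set_eqI)
    fix x
    show "x \<in> pverts (triangular_snake n) - snake_block a b A
        \<longleftrightarrow> x \<in> Base ` ({..<a} \<union> {b<..n}) \<union> Apex ` ({..<n} - A)"
      using assms by (cases x)
        (simp_all add: pverts_triangular_snake snake_block_def mem, auto)
  qed
  moreover have "card (Base ` ({..<a} \<union> {b<..n})) = a + (n - b)"
    using assms by (subst card_image, simp add: inj_on_def, subst card_Un_disjoint) auto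
  moreover have "card (Apex ` ({..<n} - A)) + card A = n"
    using assms card_mono[OF _ assms(3)]
    by (subst card_image) (auto simp: inj_on_def card_Diff_subset finite_subset)
  moreover have "card (Base ` ({..<a} \<union> {b<..n}) \<union> Apex ` ({..<n} - A))
      = card (Base ` ({..<a} \<union> {b<..n})) + card (Apex ` ({..<n} - A))"
    by (rule card_Un_disjoint) auto
  ultimately show ?thesis
    by (simp only: add.assoc)
qed

text \<open>Induction on the number of unlabeled vertices, over all blocks at once. \<open>A\<close>
  enters the count only through that number.\<close>

lemma card_completions_snake_block:
  assumes "dom l = snake_block a b A" "a \<le> b" "b \<le> n" "A \<subseteq> {a - 1..<min n (b + 1)}"
  shows "real (card (completions (triangular_snake n) l)) =
    fact (card (pverts (triangular_snake n) - dom l)) * tail_weight a * tail_weight (n - b)"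
  using assms
proof (induction "card (pverts (triangular_snake n) - dom l)" arbitrary: l a b A)
  case 0
  let ?V = "pverts (triangular_snake n)"
  have sub: "dom l \<subseteq> ?V"
    using 0 by (auto simp: snake_block_def triangular_snake_def)
  moreover have "?V - dom l = {}"
    using 0 finite_pverts_triangular_snake[of n] by simp
  \<comment> \<open>The block is the whole snake, so both weights are
    \<open>tail_weight 0 = 1\<close> and \<open>l\<close> is its only completion.\<close>
  ultimately have "dom l = ?V" by blast
  moreover from this have "Base 0 \<in> dom l" "Base n \<in> dom l"
    by (simp_all add: pverts_triangular_snake)
  then have "a = 0" "b = n"
    using 0 by (auto simp: snake_block_def)
  ultimately show ?case
    by (simp add: completions_full)
next
  case (Suc k)
  let ?H = "triangular_snake n"
  let ?V = "pverts ?H"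
  let ?P = "{a - 1..<min n (b + 1)}"
  let ?l = "\<lambda>w. l(w \<mapsto> card (dom l) + 1)"
  let ?f = "\<lambda>w. real (card (completions ?H (?l w)))"
  note prems = Suc.prems
  have sub: "dom l \<subseteq> ?V"
    using prems by (auto simp: snake_block_def triangular_snake_def)
  have ne: "dom l \<noteq> ?V"
    using Suc.hyps(2) by auto
  have fr: "frontier ?H (dom l) = Apex ` (?P - A) \<union>
      ((if a > 0 then {Base (a - 1)} else {}) \<union> (if b < n then {Base (b + 1)} else {}))"
    unfolding prems(1) by (rule frontier_snake_block[OF prems(2-4)])
  have k: "k = card (?V - dom (?l w))" if "w \<in> frontier ?H (dom l)" for w
  proof -
    have "w \<in> ?V - dom l"
      using that by (simp add: frontier_def)
    moreover have "?V - dom (?l w) = ?V - dom l - {w}"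
      by auto
    ultimately show ?thesis
      using Suc.hyps(2) by (simp only: card_Diff_singleton)
  qed
  have apex: "?f (Apex i) = fact k * tail_weight a * tail_weight (n - b)" if "i \<in> ?P - A" for i
  proof -
    have w: "Apex i \<in> frontier ?H (dom l)"
      using that fr by auto
    show ?thesis
      unfolding k[OF w]
    proof (rule Suc.hyps(1)[OF k[OF w]])
      show "dom (?l (Apex i)) = snake_block a b (insert i A)"
        using prems(1) insert_snake_block(1) by simp
    qed (use that prems in auto)
  qed
  \<comment> \<open>The new weight \<open>tail_weight (a - 1)\<close> is written as a multiple of
    \<open>tail_weight a\<close>, so that all successors share one factor.\<close>
  have left: "?f (Base (a - 1)) = fact k * ((2 * real a - 1) * tail_weight a) * tail_weight (n - b)"
    if "a > 0"
  proof -
    have w: "Base (a - 1) \<in> frontier ?H (dom l)"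
      using that fr by auto
    have "?f (Base (a - 1)) = fact k * tail_weight (a - 1) * tail_weight (n - b)"
      unfolding k[OF w]
    proof (rule Suc.hyps(1)[OF k[OF w]])
      show "dom (?l (Base (a - 1))) = snake_block (a - 1) b A"
        using prems(1,2) insert_snake_block(2)[OF that] by simp
      show "A \<subseteq> {a - 1 - 1..<min n (b + 1)}"
        by (rule order_trans[OF prems(4)]) auto
    qed (use that prems in auto)
    then show ?thesis
      using that tail_weight_Suc[of "a - 1"] by (simp add: of_nat_diff)
  qed
  have right: "?f (Base (b + 1)) =
      fact k * tail_weight a * ((2 * real (n - b) - 1) * tail_weight (n - b))" if "b < n"
  proof -
    have w: "Base (b + 1) \<in> frontier ?H (dom l)"
      using that fr by auto
    have "?f (Base (b + 1)) = fact k * tail_weight a * tail_weight (n - (b + 1))"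
      unfolding k[OF w]
    proof (rule Suc.hyps(1)[OF k[OF w]])
      show "dom (?l (Base (b + 1))) = snake_block a (b + 1) A"
        using prems(1,2) insert_snake_block(3) by simp
    qed (use that prems in auto)
    moreover have "n - b = Suc (n - (b + 1))"
      using that by simp
    ultimately show ?thesis
      using tail_weight_Suc[of "n - (b + 1)"] by simp
  qed
  have finA: "finite A"
    using prems(4) finite_subset by blast
  have "card (?P - A) + card A = card ?P"
    using card_Diff_subset[OF finA prems(4)] card_mono[OF _ prems(4)] by (simp del: card_atLeastLessThan)
  \<comment> \<open>There are \<open>b - a\<close> apexes inside the interval, plus one at each end
    where the snake goes on.\<close>
  moreover have "card ?P = b - a + of_bool (a > 0) + of_bool (b < n)"
    using prems(2,3) by (auto simp: min_def)
  moreover have "Suc k + card A = a + (n - b) + n"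
    using card_unlabeled_snake_block[OF prems(2,3), of A] prems(1,4) Suc.hyps(2) by fastforce
  ultimately have "Suc k + b + of_bool (a > 0) + of_bool (b < n) + b = card (?P - A) + 2 * a + 2 * n"
    using prems(2,3) by linarith
  \<comment> \<open>If \<open>a > 0\<close>, then \<open>a\<close> base vertices and
    \<open>a - 1\<close> apexes not touching the interval lie to its left: \<open>2 a - 1\<close>
    unlabeled vertices. The right side is alike, and the remaining unlabeled vertices are the free
    apexes that touch the interval.\<close>
  then have count: "real (Suc k) = real (card (?P - A)) + (if a > 0 then 2 * real a - 1 else 0) +
      (if b < n then 2 * real (n - b) - 1 else 0)"
    using prems(2,3) by (auto simp: of_nat_diff split: if_splits)
  have "real (card (completions ?H l)) = (\<Sum>w\<in>frontier ?H (dom l). ?f w)"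
    using card_completions_step[OF finite_pverts_triangular_snake sub ne] by simp
  also have "\<dots> = (\<Sum>w\<in>Apex ` (?P - A). ?f w) +
      ((if a > 0 then ?f (Base (a - 1)) else 0) + (if b < n then ?f (Base (b + 1)) else 0))"
    unfolding fr by (subst sum.union_disjoint) (use prems(2) in auto)
  also have "(\<Sum>w\<in>Apex ` (?P - A). ?f w)
      = real (card (?P - A)) * (fact k * tail_weight a * tail_weight (n - b))"
    using apex by (subst sum.reindex) (auto simp: inj_on_def)
  \<comment> \<open>With the common factor pulled out, the coefficients add up to
    \<open>Suc k\<close> by \<open>count\<close>, which completes \<open>fact k\<close> to
    \<open>fact (Suc k)\<close>.\<close>
  also have "\<dots> + ((if a > 0 then ?f (Base (a - 1)) else 0) + (if b < n then ?f (Base (b + 1)) else 0))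
      = real (Suc k) * (fact k * tail_weight a * tail_weight (n - b))"
  proof -
    have "(if a > 0 then ?f (Base (a - 1)) else 0) = (if a > 0 then 2 * real a - 1 else 0) *
        (fact k * tail_weight a * tail_weight (n - b))"
    proof (cases "a > 0")
      case True
      then show ?thesis
        by (simp only: if_True left mult_ac)
    qed simp
    moreover have "(if b < n then ?f (Base (b + 1)) else 0) =
        (if b < n then 2 * real (n - b) - 1 else 0) * (fact k * tail_weight a * tail_weight (n - b))"
    proof (cases "b < n")
      case True
      then show ?thesis
        by (simp only: if_True right mult_ac)
    qed simp
    ultimately show ?thesis
      unfolding count by (simp only: distrib_right add.assoc)
  qed
  finally show ?case
    unfolding Suc.hyps(2)[symmetric] by simp
qed

section \<open>Completions from a single starting vertex\<close>

lemma card_completions_Base: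
  assumes "i \<le> n"
  shows "real (card (completions (triangular_snake n) [Base i \<mapsto> 1])) =
    fact (2 * n) * tail_weight i * tail_weight (n - i)"
proof -
  have "dom [Base i \<mapsto> 1] = snake_block i i {}"
    by (simp add: snake_block_def)
  moreover have "card (pverts (triangular_snake n) - {Base i}) = 2 * n"
    using assms by (simp add: pverts_triangular_snake card_pverts_triangular_snake)
  ultimately show ?thesis
    using card_completions_snake_block[of "[Base i \<mapsto> 1]" i i "{}" n] assms by simp
qed

lemma card_completions_Apex:
  assumes "i < n"
  shows "real (card (completions (triangular_snake n) [Apex i \<mapsto> 1])) =
    fact (2 * n - 1) * (tail_weight i * tail_weight (n - i) +
      tail_weight (i + 1) * tail_weight (n - (i + 1)))"
proof -
  let ?H = "triangular_snake n"
  \<comment> \<open>The second vertex is one of the two base neighbours; then the labeled set is the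
    block \<open>{j..j}\<close> with apex \<open>i\<close>, and \<open>2 n - 1\<close> vertices
    remain. The label \<open>1 + 1\<close> is \<open>card (dom l) + 1\<close> with the cardinality
    evaluated.\<close>
  have step: "real (card (completions ?H [Apex i \<mapsto> 1, Base j \<mapsto> 1 + 1])) =
      fact (2 * n - 1) * tail_weight j * tail_weight (n - j)" if "j = i \<or> j = i + 1" for j
  proof -
    have "dom [Apex i \<mapsto> 1, Base j \<mapsto> 1 + 1] = snake_block j j {i}"
      by (auto simp: snake_block_def)
    moreover have "card (pverts ?H - {Base j, Apex i}) = 2 * n - 1"
      using assms that by (subst card_Diff_subset)
        (auto simp: pverts_triangular_snake card_pverts_triangular_snake)
    ultimately show ?thesis
      using card_completions_snake_block[of "[Apex i \<mapsto> 1, Base j \<mapsto> 1 + 1]" j j "{i}" n] assms that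
      by (auto simp: min_def)
  qed
  have "dom [Apex i \<mapsto> (1 :: nat)] \<noteq> pverts ?H"
    using pverts_triangular_snake(1)[of 0 n] by auto
  then have "card (completions ?H [Apex i \<mapsto> 1]) =
      (\<Sum>w\<in>{Base i, Base (i + 1)}. card (completions ?H [Apex i \<mapsto> 1, w \<mapsto> 1 + 1]))"
    using card_completions_step[OF finite_pverts_triangular_snake, of "[Apex i \<mapsto> 1]" n] assms
    by (simp add: frontier_Apex pverts_triangular_snake)
  then show ?thesis
    using step[of i] step[of "i + 1"] by (simp add: algebra_simps)
qed

section \<open>From weights to quotients of binomial coefficients\<close>

text \<open>Both sides equal \<open>2^n k! (n - k)! (2 n)! / ((2 k)! (2 n - 2 k)!)\<close>.\<close>

lemma tail_weight_prod_even:
  assumes "k \<le> n"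
  shows "fact (2 * n) * (tail_weight k * tail_weight (n - k)) =
    2 ^ n * fact n * (real ((2 * n) choose (2 * k)) / real (n choose k))"
proof -
  have "(2::real) ^ n = 2 ^ k * 2 ^ (n - k)"
    using assms by (simp flip: power_add)
  moreover have "2 * n - 2 * k = 2 * (n - k)"
    by simp
  ultimately show ?thesis
    using assms by (simp add: tail_weight_def binomial_fact field_simps)
qed

lemma tail_weight_prod_odd:
  assumes "k < n"
  shows "fact (2 * n - 1) * (tail_weight k * tail_weight (n - k)) =
    2 ^ (n - 1) * fact (n - 1) * (real ((2 * n - 1) choose (2 * k)) / real ((n - 1) choose k))"
proof -
  define m where "m = n - 1 - k"
  have n: "n = k + m + 1"
    using assms by (simp add: m_def)
  \<comment> \<open>Cancelling \<open>2 (m + 1)\<close>, possible because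
    \<open>n - k = m + 1\<close> is positive, lowers \<open>(2 n - 2 k)!\<close> to
    \<open>(2 n - 2 k - 1)!\<close>, the factorial in \<open>(2 n - 1) choose (2 k)\<close>.\<close>
  have "tail_weight (m + 1) = 2 ^ m * fact m / fact (2 * m + 1)"
    by (simp add: tail_weight_def divide_simps)
  moreover have "n - k = m + 1" "2 * n - 1 - 2 * k = 2 * m + 1" "n - 1 - k = m"
    "(2::real) ^ (n - 1) = 2 ^ k * 2 ^ m"
    using n by (simp_all add: power_add)
  moreover have "2 * k \<le> 2 * n - 1" "k \<le> n - 1"
    using assms by simp_all
  ultimately show ?thesis
    by (simp add: tail_weight_def[of k] binomial_fact field_simps del: fact_Suc)
qed

section \<open>Summation over the starting vertex\<close>

theorem corollary10:
  fixes n :: nat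
  assumes "n \<ge> 1"
  shows "real (num_rw_labelings (triangular_snake n)) =
    2 ^ n * fact (n - 1) *
      ((\<Sum>k=0..n-1. real ((2 * n - 1) choose (2 * k)) / real ((n - 1) choose k)) +
       real n * (\<Sum>k=0..n. real ((2 * n) choose (2 * k)) / real (n choose k)))"
proof -
  let ?H = "triangular_snake n"
  let ?c = "\<lambda>v. real (card (completions ?H [v \<mapsto> 1]))"
  let ?g = "\<lambda>i. fact (2 * n - 1) * (tail_weight i * tail_weight (n - i))"
  let ?S = "\<Sum>k=0..n-1. real ((2 * n - 1) choose (2 * k)) / real ((n - 1) choose k)"
  \<comment> \<open>This relies on \<open>n \<ge> 1\<close>: at \<open>n = 0\<close> truncated
    subtraction would make the left side \<open>{0}\<close>.\<close>
  have idx: "{0..n - 1} = {..<n}"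
    using assms by auto
  have "parcs ?H \<subseteq> pverts ?H \<times> pverts ?H" "sym (parcs ?H)"
    by (auto simp: triangular_snake_def snake_half_arcs_def sym_def)
  then have "real (num_rw_labelings ?H) = (\<Sum>v\<in>pverts ?H. ?c v)"
    using num_rw_labelings_eq_sum[OF finite_pverts_triangular_snake] by simp
  also have "\<dots> = (\<Sum>v\<in>Base ` {..n}. ?c v) + (\<Sum>v\<in>Apex ` {..<n}. ?c v)"
    unfolding triangular_snake_def pair_pre_digraph.simps by (rule sum.union_disjoint) auto
  also have "(\<Sum>v\<in>Base ` {..n}. ?c v) = (\<Sum>i\<le>n. ?c (Base i))"
    by (subst sum.reindex) (auto simp: inj_on_def)
  also have "\<dots> = (\<Sum>i\<le>n. 2 ^ n * fact n * (real ((2 * n) choose (2 * i)) / real (n choose i)))"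
    by (intro sum.cong refl)
      (simp only: atMost_iff card_completions_Base mult.assoc tail_weight_prod_even)
  \<comment> \<open>Splitting \<open>n! = n (n - 1)!\<close> exposes the factor shared with the apex
    part.\<close>
  also have "\<dots> = 2 ^ n * fact (n - 1) *
      (real n * (\<Sum>k=0..n. real ((2 * n) choose (2 * k)) / real (n choose k)))"
    using assms by (simp add: atMost_atLeast0 fact_reduce[of n] sum_distrib_left mult_ac)
  also have "(\<Sum>v\<in>Apex ` {..<n}. ?c v) = (\<Sum>i<n. ?c (Apex i))"
    by (subst sum.reindex) (auto simp: inj_on_def)
  \<comment> \<open>The term of \<open>Apex i\<close> with weights at \<open>i + 1\<close> is
    \<open>?g (n - Suc i)\<close>, as the product is symmetric. Reflected in this way, both sums use
    only indices below \<open>n\<close>, where \<open>tail_weight_prod_odd\<close> applies.\<close>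
  also have "\<dots> = (\<Sum>i<n. ?g i) + (\<Sum>i<n. ?g (n - Suc i))"
    unfolding sum.distrib[symmetric]
  proof (rule sum.cong)
    fix i assume "i \<in> {..<n}"
    then have "i < n" "n - (n - Suc i) = i + 1" by auto
    then show "?c (Apex i) = ?g i + ?g (n - Suc i)"
      by (simp only: card_completions_Apex) (simp add: algebra_simps)
  qed simp
  also have "(\<Sum>i<n. ?g (n - Suc i)) = (\<Sum>i<n. ?g i)"
    by (rule sum.nat_diff_reindex)
  also have "(\<Sum>i<n. ?g i) = 2 ^ (n - 1) * fact (n - 1) * ?S"
    unfolding idx sum_distrib_left
    by (intro sum.cong refl) (simp only: lessThan_iff tail_weight_prod_odd)
  \<comment> \<open>The two equal apex sums turn \<open>2 ^ (n - 1)\<close> into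
    \<open>2 ^ n\<close>.\<close>
  also have "\<dots> + \<dots> = 2 ^ n * fact (n - 1) * ?S"
    using assms by (cases n) auto
  finally show ?thesis
    by (simp add: algebra_simps)
qed

end
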